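(* Let $d\ge 1$ and let $S\subseteq\mathbb{N}_0^d$ be a Frobenius generalized numerical semigroup with Frobenius element $\mathbf{f}$. Then $S$ is almost symmetric if and only if there exists an irreducible generalized numerical semigroup $T\subseteq\mathbb{N}_0^d$ having Frobenius element $\mathbf{f}$ such that $S=T\setminus A$, where $A$ is a subset of minimal generators of $T$ satisfying $$\operatorname{PF}(S)=\operatorname{PF}(T) \cup \{\mathbf{x}, \mathbf{f}-\mathbf{x} \mid \mathbf{x}\in A\}.$$ In this case, $\operatorname{t}(S)=2|A|+\operatorname{t}(T)$.
   Context: $\mathbb{N}_0$ is the set of nonnegative integers. A generalized numerical semigroup (GNS) is a submonoid $S$ of $(\mathbb{N}_0^d,+)$ (closed under addition, containing $\mathbf{0}$) whose complement $\operatorname{H}(S)=\mathbb{N}_0^d\setminus S$ (the set of gaps) is finite. Its genus is $\operatorname{g}(S)=|\operatorname{H}(S)|$. Put $S^*=S\setminus\{\mathbf{0}\}$. The set of pseudo-Frobenius elements is $\operatorname{PF}(S)=\{\mathbf{h}\in\operatorname{H}(S)\mid \mathbf{h}+\mathbf{s}\in S\text{ for all }\mathbf{s}\in S^*\}$, and the type of $S$ is $\operatorname{t}(S)=|\operatorname{PF}(S)|$. For $\mathbf{x}=(x^{(1)},\dots,x^{(d)})\in\mathbb{N}_0^d$, $|\mathbf{x}|_\times=x^{(1)}\cdots x^{(d)}$, and $\mathbf{x}+\mathbf{1}$ is the vector with components $x^{(i)}+1$. The symbol $\le$ denotes the componentwise partial order. $S$ is a Frobenius GNS if $\operatorname{H}(S)$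 has a unique maximal element with respect to $\le$; this element is called the Frobenius element of $S$. $S$ is almost symmetric if $2\operatorname{g}(S)+1-\operatorname{t}(S)=|\mathbf{h}+\mathbf{1}|_\times$ for some $\mathbf{h}\in\operatorname{H}(S)$. A GNS is irreducible if it cannot be expressed as the intersection of two GNSs properly containing it. A minimal generator of a GNS $T$ is an element of $T^*\setminus(T^*+T^* )$. *)

theory Defs
  imports "HOL-Analysis.Finite_Cartesian_Product"
begin

text \<open>
  The monoid of \<open>d\<close>-tuples of nonnegative integers is the type \<open>nat ^ 'd\<close>, with \<open>d = CARD('d)\<close>;
  its library operations \<open>0\<close>, \<open>1\<close>, \<open>+\<close>, \<open>-\<close> and its order \<open>\<le>\<close> are componentwise.
\<close>

definition gaps :: "(nat ^ 'd) set \<Rightarrow> (nat ^ 'd) set" where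
  "gaps S = - S"

definition gns :: "(nat ^ 'd) set \<Rightarrow> bool" where
  "gns S \<longleftrightarrow> 0 \<in> S \<and> (\<forall>a\<in>S. \<forall>b\<in>S. a + b \<in> S) \<and> finite (gaps S)"

definition genus :: "(nat ^ 'd) set \<Rightarrow> nat" where
  "genus S = card (gaps S)"

definition pseudo_frobenius :: "(nat ^ 'd) set \<Rightarrow> (nat ^ 'd) set" where
  "pseudo_frobenius S = {h \<in> gaps S. \<forall>s \<in> S - {0}. h + s \<in> S}"

definition gns_type :: "(nat ^ 'd) set \<Rightarrow> nat" where
  "gns_type S = card (pseudo_frobenius S)"

definition comp_prod :: "nat ^ 'd \<Rightarrow> nat" where
  "comp_prod x = (\<Prod>i\<in>UNIV. x $ i)"

definition maximal_gaps :: "(nat ^ 'd) set \<Rightarrow> (nat ^ 'd) set" where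
  "maximal_gaps S = {h \<in> gaps S. \<not> (\<exists>k \<in> gaps S. h < k)}"

definition frobenius_gns :: "(nat ^ 'd) set \<Rightarrow> nat ^ 'd \<Rightarrow> bool" where
  \<comment> \<open>\<open>S\<close> is a Frobenius GNS and \<open>f\<close> is its Frobenius element.\<close>
  "frobenius_gns S f \<longleftrightarrow> gns S \<and> maximal_gaps S = {f}"

definition almost_symmetric :: "(nat ^ 'd) set \<Rightarrow> bool" where
  "almost_symmetric S \<longleftrightarrow>
     (\<exists>h \<in> gaps S. 2 * int (genus S) + 1 - int (gns_type S) = int (comp_prod (h + 1)))"

definition irreducible_gns :: "(nat ^ 'd) set \<Rightarrow> bool" where
  "irreducible_gns S \<longleftrightarrow>
     gns S \<and> \<not> (\<exists>S1 S2. gns S1 \<and> gns S2 \<and> S \<subset> S1 \<and> S \<subset> S2 \<and> S = S1 \<inter> S2)"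

definition minimal_generators :: "(nat ^ 'd) set \<Rightarrow> (nat ^ 'd) set" where
  "minimal_generators T = (T - {0}) - {a + b |a b. a \<in> T - {0} \<and> b \<in> T - {0}}"

definition almost_symmetric_decomposition ::
    "(nat ^ 'd) set \<Rightarrow> nat ^ 'd \<Rightarrow> (nat ^ 'd) set \<Rightarrow> (nat ^ 'd) set \<Rightarrow> bool" where
  \<comment> \<open>The subtraction \<open>f - x\<close> is truncated, but when \<open>f\<close> is the Frobenius element of \<open>S\<close> it is only
    applied to gaps \<open>x\<close> of \<open>S\<close>, which satisfy \<open>x \<le> f\<close> by \<open>gap_le_frobenius\<close> below.\<close>
  "almost_symmetric_decomposition S f T A \<longleftrightarrow>
     irreducible_gns T \<and> frobenius_gns T f \<and> A \<subseteq> minimal_generators T \<and> S = T - A \<and>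
     pseudo_frobenius S = pseudo_frobenius T \<union> (\<Union>x\<in>A. {x, f - x})"

lemma gap_le_frobenius:
  assumes "frobenius_gns S f" and "h \<in> gaps S"
  shows "h \<le> f"
proof -
  have "finite (gaps S)"
    using assms(1) by (simp add: frobenius_gns_def gns_def)
  then obtain m where m: "m \<in> gaps S" "h \<le> m" "\<forall>b\<in>gaps S. m \<le> b \<longrightarrow> m = b"
    using finite_has_maximal2[OF _ assms(2)] by blast
  then have "m \<in> maximal_gaps S"
    by (auto simp: maximal_gaps_def less_le)
  then show ?thesis
    using assms(1) m(2) by (auto simp: frobenius_gns_def)
qed

end

theory Submission
  imports Defs
begin

text \<open>
  Everything is governed by the reflection \<open>x \<mapsto> f - x\<close> of the box
  \<open>{x. x \<le> f}\<close>, which contains all gaps. Since \<open>f\<close> is a gap, the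
  reflection of an element of \<open>S\<close> in the box is a gap; the obstruction to symmetry is the
  set \<open>L\<close> of \<^emph>\<open>mirror gaps\<close>, the gaps whose reflection is a gap as
  well.

  Counting the box gives \<open>2 g = |f + 1| + |L|\<close>, and
  \<open>PF(S) - {f} \<subseteq> L\<close>, because for \<open>h \<in> PF(S)\<close> the sum
  \<open>h + (f - h) = f\<close> is not in \<open>S\<close>, so that \<open>f - h\<close> is a gap
  unless it is zero. Hence \<open>2 g + 1 - t \<ge> |f + 1|\<close>. As \<open>|h + 1|\<close> is
  largest for the gap \<open>h = f\<close>, almost symmetry says exactly that
  \<open>L \<subseteq> PF(S)\<close> (\<open>almost_symmetric_iff\<close>). Irreducibility, on the
  other hand, says that the only possible mirror gap is the midpoint \<open>f / 2\<close>
  (\<open>irreducible_iff\<close>).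

  So an irreducible \<open>T\<close> is obtained from an almost symmetric \<open>S\<close> by adding
  one point of each pair \<open>{x, f - x}\<close> in \<open>L\<close> with
  \<open>x \<noteq> f - x\<close>. Adding elements of \<open>PF(S)\<close> to \<open>S\<close> can
  only spoil closure through sums of two added points. Choosing always the lexicographically larger
  point of the pair pushes these sums out of the box (\<open>exists_upper_half\<close>), hence into
  \<open>S\<close>. Then all sums of two nonzero elements of \<open>T\<close> lie in \<open>S\<close>,
  so that the added points are minimal generators. Conversely, every mirror gap of
  \<open>T - A\<close> is the midpoint or belongs to a pair \<open>{x, f - x}\<close> with
  \<open>x \<in> A\<close>. The pairs are pseudo-Frobenius by hypothesis, the midpoint is because
  \<open>T\<close> is irreducible (\<open>midpoint_in_pseudo_frobenius\<close>).
\<close>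

section \<open>Reflection in a box\<close>

lemma add_reflect: "x \<le> f \<Longrightarrow> x + (f - x) = f" for x f :: "nat ^ 'd"
  by (simp add: vec_eq_iff less_eq_vec_def)

lemma reflect_le: "f - x \<le> f" for x f :: "nat ^ 'd"
  by (simp add: less_eq_vec_def)

lemma reflect_reflect: "x \<le> f \<Longrightarrow> f - (f - x) = x" for x f :: "nat ^ 'd"
  by (simp add: vec_eq_iff less_eq_vec_def)

lemma reflect_add: "y + s \<le> f \<Longrightarrow> (f - (y + s)) + s = f - y" for y s f :: "nat ^ 'd"
proof -
  assume le: "y + s \<le> f"
  have "f $ i - (y $ i + s $ i) + s $ i = f $ i - y $ i" for i
  proof -
    have "y $ i + s $ i \<le> f $ i"
      using le by (simp add: less_eq_vec_def)
    then show ?thesis by linarith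
  qed
  then show ?thesis by (simp add: vec_eq_iff)
qed

lemma le_add_left: "y \<le> y + s" for y s :: "nat ^ 'd"
  by (simp add: less_eq_vec_def)

lemma reflect_eq_self_iff: "x \<le> f \<Longrightarrow> f - x = x \<longleftrightarrow> x + x = f" for x f :: "nat ^ 'd"
  by (metis add_reflect add_diff_cancel_left')

lemma less_add: "s \<noteq> 0 \<Longrightarrow> y < y + s" for y s :: "nat ^ 'd"
  by (simp add: less_le le_add_left)

lemma finite_box: "finite {x :: nat ^ 'd. x \<le> f}"
  and card_box: "card {x :: nat ^ 'd. x \<le> f} = comp_prod (f + 1)"
proof -
  let ?P = "Pi\<^sub>E (UNIV :: 'd set) (\<lambda>i. {..f $ i})"
  have bij: "bij_betw vec_lambda ?P {x :: nat ^ 'd. x \<le> f}"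
    by (rule bij_betw_byWitness[where f' = vec_nth])
      (auto simp: less_eq_vec_def PiE_def Pi_def)
  have "finite ?P"
    by (intro finite_PiE) auto
  with bij show "finite {x :: nat ^ 'd. x \<le> f}"
    using bij_betw_finite by blast
  show "card {x :: nat ^ 'd. x \<le> f} = comp_prod (f + 1)"
    using bij_betw_same_card[OF bij] by (simp add: card_PiE comp_prod_def)
qed

text \<open>
  The lexicographic order, for an arbitrary enumeration of the coordinates, compares \<open>x\<close> with
  \<open>f - x\<close>; the upper half consists of the points \<open>x\<close> that win. If \<open>x\<close> and \<open>y\<close> both win, then at the
  first coordinate where one of \<open>x + x\<close>, \<open>y + y\<close> differs from \<open>f\<close> the sum \<open>(x + x) + (y + y)\<close>
  exceeds \<open>f + f\<close>, so that \<open>x + y\<close> leaves the box.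
\<close>
lemma exists_upper_half:
  fixes f :: "nat ^ 'd"
  obtains U where "\<And>x. x \<le> f \<Longrightarrow> x + x \<noteq> f \<Longrightarrow> x \<in> U \<longleftrightarrow> f - x \<notin> U"
    and "\<And>x y. x \<in> U \<Longrightarrow> y \<in> U \<Longrightarrow> \<not> x + y \<le> f"
proof -
  obtain idx :: "'d \<Rightarrow> nat" where inj: "inj idx"
    using finite_imp_inj_to_nat_seg[OF finite[of "UNIV :: 'd set"]] by blast
  define U :: "(nat ^ 'd) set" where
    "U = {x. \<exists>i. f $ i < 2 * x $ i \<and> (\<forall>j. idx j < idx i \<longrightarrow> 2 * x $ j = f $ j)}"
  have sum: "\<not> x + y \<le> f" if xU: "x \<in> U" and yU: "y \<in> U" for x y
  proof -
    obtain i where i: "f $ i < 2 * x $ i" "\<And>j. idx j < idx i \<Longrightarrow> 2 * x $ j = f $ j"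
      using xU by (auto simp: U_def)
    obtain k where k: "f $ k < 2 * y $ k" "\<And>j. idx j < idx k \<Longrightarrow> 2 * y $ j = f $ j"
      using yU by (auto simp: U_def)
    consider "idx i < idx k" | "idx k < idx i" | "i = k"
      using inj by (meson injD linorder_neqE_nat)
    then have "\<exists>m. f $ m < x $ m + y $ m"
    proof cases
      case 1
      with i(1) k(2)[OF 1] show ?thesis by (intro exI[of _ i]) linarith
    next
      case 2
      with k(1) i(2)[OF 2] show ?thesis by (intro exI[of _ k]) linarith
    next
      case 3
      with i(1) k(1) show ?thesis by (intro exI[of _ i]) simp
    qed
    then show ?thesis
      by (auto simp: less_eq_vec_def not_le)
  qed
  have half: "x \<in> U \<longleftrightarrow> f - x \<notin> U" if le: "x \<le> f" and ne: "x + x \<noteq> f" for x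
  proof -
    have "\<exists>i. x $ i + x $ i \<noteq> f $ i"
      using ne by (auto simp: vec_eq_iff)
    then obtain i where i: "2 * x $ i \<noteq> f $ i"
      and least: "\<And>j. idx j < idx i \<Longrightarrow> 2 * x $ j = f $ j"
      using arg_min_natI[of "\<lambda>i. 2 * x $ i \<noteq> f $ i" _ idx]
        arg_min_nat_le[of "\<lambda>i. 2 * x $ i \<noteq> f $ i" _ idx]
      by (metis (no_types, lifting) mult_2 not_le)
    have le': "x $ j \<le> f $ j" for j
      using le by (simp add: less_eq_vec_def)
    have least': "2 * (f - x) $ j = f $ j" if "idx j < idx i" for j
      using least[OF that] by simp
    have "x \<in> U \<or> f - x \<in> U"
    proof (cases "f $ i < 2 * x $ i")
      case True
      then show ?thesis using least by (auto simp: U_def)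
    next
      case False
      then have "f $ i < 2 * (f - x) $ i"
        using i le'[of i] by simp
      then show ?thesis using least' by (auto simp: U_def)
    qed
    moreover have "\<not> (x \<in> U \<and> f - x \<in> U)"
      using sum[of x "f - x"] add_reflect[OF le] by auto
    ultimately show ?thesis by blast
  qed
  from half sum show thesis by (rule that)
qed

section \<open>Mirror gaps and almost symmetry\<close>

definition mirror_gaps :: "(nat ^ 'd) set \<Rightarrow> nat ^ 'd \<Rightarrow> (nat ^ 'd) set" where
  "mirror_gaps S f = {h \<in> gaps S. f - h \<in> gaps S}"

lemma frobenius_gnsD:
  assumes "frobenius_gns S f"
  shows "0 \<in> S" and "\<And>a b. a \<in> S \<Longrightarrow> b \<in> S \<Longrightarrow> a + b \<in> S" and "f \<notin> S"
    and "\<And>x. x \<notin> S \<Longrightarrow> x \<le> f" and "finite (gaps S)"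
  using assms gap_le_frobenius[OF assms]
  by (auto simp: frobenius_gns_def gns_def gaps_def maximal_gaps_def)

lemma frobenius_gnsI:
  assumes "gns T" and "f \<notin> T" and "\<And>x. x \<notin> T \<Longrightarrow> x \<le> f"
  shows "frobenius_gns T f"
  using assms by (force simp: frobenius_gns_def maximal_gaps_def gaps_def)

lemma frobenius_add:
  assumes "frobenius_gns S f" and "s \<noteq> 0"
  shows "f + s \<in> S"
  using frobenius_gnsD(4)[OF assms(1), of "f + s"] less_add[OF assms(2), of f]
  by (metis less_le_not_le)

lemma frobenius_in_pseudo_frobenius:
  assumes "frobenius_gns S f"
  shows "f \<in> pseudo_frobenius S"
  using frobenius_add[OF assms] frobenius_gnsD(3)[OF assms]
  by (auto simp: pseudo_frobenius_def gaps_def)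

lemma pseudo_frobenius_subset:
  assumes "frobenius_gns S f"
  shows "pseudo_frobenius S \<subseteq> insert f (mirror_gaps S f)"
proof
  fix h assume h: "h \<in> pseudo_frobenius S"
  then have le: "h \<le> f" and gap: "h \<notin> S"
    using frobenius_gnsD(4)[OF assms] by (auto simp: pseudo_frobenius_def gaps_def)
  show "h \<in> insert f (mirror_gaps S f)"
  proof (cases "f - h \<in> S")
    case True
    have "f - h = 0"
      using h True add_reflect[OF le] frobenius_gnsD(3)[OF assms]
      by (force simp: pseudo_frobenius_def)
    then show ?thesis using add_reflect[OF le] by simp
  next
    case False
    with gap show ?thesis by (simp add: mirror_gaps_def gaps_def)
  qed
qed

lemma frobenius_not_mirror_gap:
  assumes "frobenius_gns S f"
  shows "f \<notin> mirror_gaps S f"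
  using frobenius_gnsD(1)[OF assms] by (simp add: mirror_gaps_def gaps_def)

text \<open>
  Reflection maps the non-gaps of the box injectively to gaps, and the gaps that it misses are the
  mirror gaps.
\<close>
lemma twice_genus:
  assumes "frobenius_gns S f"
  shows "2 * genus S = comp_prod (f + 1) + card (mirror_gaps S f)"
proof -
  note D = frobenius_gnsD[OF assms]
  let ?N = "{x. x \<le> f} \<inter> S" and ?L = "mirror_gaps S f"
  have finN: "finite ?N"
    using finite_box by blast
  have finL: "finite ?L"
    using D(5) by (simp add: mirror_gaps_def)
  have box: "{x. x \<le> f} = ?N \<union> gaps S"
    using D(4) by (auto simp: gaps_def)
  have "card {x. x \<le> f} = card ?N + genus S"
    unfolding genus_def by (subst box, rule card_Un_disjoint) (use finN D(5) in \<open>auto simp: gaps_def\<close>)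
  moreover have "gaps S = (\<lambda>x. f - x) ` ?N \<union> ?L"
  proof (intro equalityI subsetI)
    fix x assume x: "x \<in> gaps S"
    show "x \<in> (\<lambda>x. f - x) ` ?N \<union> ?L"
    proof (cases "f - x \<in> S")
      case True
      have "x = f - (f - x)"
        using x D(4) by (simp add: reflect_reflect gaps_def)
      then show ?thesis using True reflect_le by blast
    next
      case False
      with x show ?thesis by (simp add: mirror_gaps_def gaps_def)
    qed
  next
    fix x assume "x \<in> (\<lambda>x. f - x) ` ?N \<union> ?L"
    then show "x \<in> gaps S"
    proof
      assume "x \<in> (\<lambda>x. f - x) ` ?N"
      then obtain y where "x = f - y" "y \<in> S" "y \<le> f" by auto
      then show ?thesis
        using D(2)[of y x] D(3) add_reflect[of y f] by (auto simp: gaps_def)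
    qed (simp add: mirror_gaps_def)
  qed
  moreover have "card ((\<lambda>x. f - x) ` ?N \<union> ?L) = card ((\<lambda>x. f - x) ` ?N) + card ?L"
    by (rule card_Un_disjoint)
      (use finN finL in \<open>auto simp: mirror_gaps_def gaps_def reflect_reflect\<close>)
  moreover have "card ((\<lambda>x. f - x) ` ?N) = card ?N"
    by (rule card_image, rule inj_on_inverseI[where g = "\<lambda>x. f - x"]) (simp add: reflect_reflect)
  ultimately show ?thesis
    using card_box[of f] by (simp add: genus_def)
qed

lemma comp_prod_mono: "x \<le> y \<Longrightarrow> comp_prod x \<le> comp_prod y"
  unfolding comp_prod_def by (rule prod_mono) (simp add: less_eq_vec_def)

text \<open>
  By \<open>twice_genus\<close>, the condition \<open>2 g + 1 - t = |h + 1|\<close> compares \<open>t - 1\<close>, the number of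
  pseudo-Frobenius elements other than \<open>f\<close>, with \<open>|L|\<close>. These elements lie in \<open>L\<close>, so that
  \<open>2 g + 1 - t \<ge> |f + 1| \<ge> |h + 1|\<close>, and equality forces them to exhaust \<open>L\<close>.
\<close>
lemma almost_symmetric_iff:
  assumes "frobenius_gns S f"
  shows "almost_symmetric S \<longleftrightarrow> mirror_gaps S f \<subseteq> pseudo_frobenius S"
proof -
  let ?L = "mirror_gaps S f" and ?P = "pseudo_frobenius S"
  have finL: "finite ?L"
    using frobenius_gnsD(5)[OF assms] by (simp add: mirror_gaps_def)
  have sub: "?P \<subseteq> insert f ?L"
    by (rule pseudo_frobenius_subset[OF assms])
  have cardL: "card (insert f ?L) = card ?L + 1"
    using finL frobenius_not_mirror_gap[OF assms] by simp
  show ?thesis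
  proof
    assume "almost_symmetric S"
    then obtain h where h: "h \<in> gaps S"
      "2 * int (genus S) + 1 - int (gns_type S) = int (comp_prod (h + 1))"
      by (auto simp: almost_symmetric_def)
    have "h + 1 \<le> f + 1"
      using gap_le_frobenius[OF assms h(1)] by (simp add: less_eq_vec_def)
    then have "comp_prod (h + 1) \<le> comp_prod (f + 1)"
      by (rule comp_prod_mono)
    then have "card (insert f ?L) \<le> card ?P"
      using h(2) twice_genus[OF assms] cardL by (simp add: gns_type_def)
    then have "?P = insert f ?L"
      using card_seteq[OF _ sub] finL by simp
    then show "?L \<subseteq> ?P" by blast
  next
    assume "?L \<subseteq> ?P"
    then have "?P = insert f ?L"
      using sub frobenius_in_pseudo_frobenius[OF assms] by blast
    then have "2 * int (genus S) + 1 - int (gns_type S) = int (comp_prod (f + 1))"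
      using twice_genus[OF assms] cardL by (simp add: gns_type_def)
    then show "almost_symmetric S"
      using frobenius_gnsD(3)[OF assms] by (auto simp: almost_symmetric_def gaps_def)
  qed
qed

section \<open>Mirror gaps and irreducibility\<close>

lemma mirror_gaps_reflect:
  assumes "frobenius_gns S f" and "x \<in> mirror_gaps S f"
  shows "f - x \<in> mirror_gaps S f"
  using assms frobenius_gnsD(4)[OF assms(1), of x]
  by (simp add: mirror_gaps_def gaps_def reflect_reflect)

lemma gns_insert:
  assumes "gns T" and pf: "\<And>s. s \<in> T \<Longrightarrow> s \<noteq> 0 \<Longrightarrow> z + s \<in> T" and double: "z + z \<in> T"
  shows "gns (insert z T)"
  unfolding gns_def
proof (intro conjI ballI)
  have T: "0 \<in> T" "\<And>a b. a \<in> T \<Longrightarrow> b \<in> T \<Longrightarrow> a + b \<in> T" "finite (gaps T)"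
    using assms(1) by (auto simp: gns_def)
  show "0 \<in> insert z T"
    using T(1) by simp
  show "finite (gaps (insert z T))"
    using T(3) by (rule rev_finite_subset) (auto simp: gaps_def)
  fix a b assume "a \<in> insert z T" "b \<in> insert z T"
  then consider "a \<in> T" "b \<in> T" | "a = z" "b = z" | "a = z" "b \<in> T" | "a \<in> T" "b = z"
    by blast
  then show "a + b \<in> insert z T"
  proof cases
    case 1
    then show ?thesis using T(2) by simp
  next
    case 2
    then show ?thesis using double by simp
  next
    case 3
    then show ?thesis using pf[of b] by (cases "b = 0") auto
  next
    case 4
    then show ?thesis using pf[of a] by (cases "a = 0") (auto simp: add.commute)
  qed
qed

text \<open>
  Let \<open>h\<close> be maximal among the mirror gaps other than the midpoint; these are closed under
  reflection. If \<open>h + s\<close> were a gap, it would be a mirror gap, as \<open>f - h = (f - (h + s)) + s\<close>. By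
  maximality it would be the midpoint, but then \<open>f - h\<close> would be larger than \<open>h\<close>. A similar argument
  applies to \<open>h + h\<close>. So \<open>T\<close> stays a semigroup when \<open>h\<close> is added, just as when \<open>f\<close> is added, and the
  two enlargements meet in \<open>T\<close>.
\<close>
lemma irreducible_mirror_gap_midpoint:
  assumes fT: "frobenius_gns T f" and irr: "irreducible_gns T" and x: "x \<in> mirror_gaps T f"
  shows "x + x = f"
proof (rule ccontr)
  note D = frobenius_gnsD[OF fT]
  assume "x + x \<noteq> f"
  let ?M = "{x \<in> mirror_gaps T f. x + x \<noteq> f}"
  have "finite ?M" "?M \<noteq> {}"
    using D(5) x \<open>x + x \<noteq> f\<close> by (auto simp: mirror_gaps_def)
  then obtain h where h: "h \<in> ?M" and max: "\<And>y. y \<in> ?M \<Longrightarrow> h \<le> y \<Longrightarrow> h = y"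
    using finite_has_maximal[of ?M] by blast
  have gap: "h \<notin> T" "f - h \<notin> T" and hf: "h \<le> f"
    using h D(4) by (auto simp: mirror_gaps_def gaps_def)
  have h0: "h \<noteq> 0"
    using gap D(1) by auto
  have reflect_M: "f - h \<in> ?M"
    using h hf mirror_gaps_reflect[OF fT] reflect_eq_self_iff[of "f - h" f]
      reflect_eq_self_iff[of h f] reflect_reflect[OF hf] reflect_le[of f h]
    by auto
  \<comment> \<open>The reflection of \<open>h\<close> is another candidate, so it cannot lie above \<open>h\<close>.\<close>
  have not_below: "\<not> h + h + u = f" for u
  proof
    assume eq: "h + h + u = f"
    then have "f - h = h + u"
      by (metis add.assoc add_diff_cancel_left')
    then have "h = f - h"
      using max[OF reflect_M] le_add_left[of h u] by simp
    then show False
      using h reflect_eq_self_iff[OF hf] by simp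
  qed
  have mid: "f - (h + s) \<in> T" if "s \<noteq> 0" "h + s \<notin> T" for s
  proof (rule ccontr)
    assume *: "f - (h + s) \<notin> T"
    have "h + s + (h + s) \<noteq> f"
      using not_below[of "s + s"] by (simp add: ac_simps)
    then have "h + s \<in> ?M"
      using that * by (simp add: mirror_gaps_def gaps_def)
    then show False
      using max[of "h + s"] less_add[OF that(1), of h] le_add_left[of h s] by simp
  qed
  have pf: "h + s \<in> T" if "s \<in> T" "s \<noteq> 0" for s
  proof (rule ccontr)
    assume *: "h + s \<notin> T"
    have "f - (h + s) + s \<in> T"
      using mid[OF that(2) *] that(1) D(2) by blast
    then show False
      using reflect_add[OF D(4)[OF *]] gap by simp
  qed
  have double: "h + h \<in> T"
  proof (rule ccontr)
    assume *: "h + h \<notin> T"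
    have "f - (h + h) \<in> T" "f - (h + h) \<noteq> 0"
      using mid[OF h0 *] add_reflect[OF D(4)[OF *]] not_below[of 0] by auto
    then have "f - (h + h) + h \<in> T"
      using pf[of "f - (h + h)"] by (metis add.commute)
    then show False
      using reflect_add[OF D(4)[OF *]] gap by simp
  qed
  have f0: "f \<noteq> 0"
    using D(1,3) by auto
  have "gns T"
    using fT by (simp add: frobenius_gns_def)
  then have gns_h: "gns (insert h T)" and gns_f: "gns (insert f T)"
    using pf double frobenius_add[OF fT] f0 by (simp_all add: gns_insert)
  have "h \<noteq> f"
    using gap D(1) by auto
  then have "T = insert h T \<inter> insert f T" "T \<subset> insert h T" "T \<subset> insert f T"
    using gap D(3) by auto
  then show False
    using irr gns_h gns_f unfolding irreducible_gns_def by blast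
qed

text \<open>
  If \<open>T\<close> is an intersection of two larger semigroups, one of them misses \<open>f\<close>; but it contains a gap
  \<open>x\<close> of \<open>T\<close>, hence also \<open>f\<close>, written as \<open>x + (f - x)\<close> or as \<open>x + x\<close>.
\<close>
lemma irreducible_iff:
  assumes fT: "frobenius_gns T f"
  shows "irreducible_gns T \<longleftrightarrow> (\<forall>x \<in> mirror_gaps T f. x + x = f)"
proof
  assume "irreducible_gns T"
  then show "\<forall>x \<in> mirror_gaps T f. x + x = f"
    using irreducible_mirror_gap_midpoint[OF fT] by blast
next
  assume mid: "\<forall>x \<in> mirror_gaps T f. x + x = f"
  note D = frobenius_gnsD[OF fT]
  have key: "f \<in> V" if V: "gns V" "T \<subset> V" for V
  proof -
    obtain x where x: "x \<in> V" "x \<notin> T"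
      using V(2) by blast
    have closed: "a + b \<in> V" if "a \<in> V" "b \<in> V" for a b
      using V(1) that by (auto simp: gns_def)
    show ?thesis
    proof (cases "f - x \<in> T")
      case True
      then show ?thesis
        using closed[of x "f - x"] x V(2) add_reflect[OF D(4)[OF x(2)]] by auto
    next
      case False
      then have "x + x = f"
        using mid x by (auto simp: mirror_gaps_def gaps_def)
      then show ?thesis
        using closed[of x x] x by simp
    qed
  qed
  show "irreducible_gns T"
    using fT key D(3) unfolding irreducible_gns_def frobenius_gns_def by blast
qed

text \<open>
  If the midpoint plus \<open>s\<close> is a gap, it is no longer the midpoint, so its reflection is in \<open>T\<close>, and
  adding \<open>s\<close> to that reflection yields the midpoint again.
\<close>
lemma midpoint_in_pseudo_frobenius:
  assumes fT: "frobenius_gns T f" and irr: "irreducible_gns T"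
    and y: "y \<notin> T" "y + y = f"
  shows "y \<in> pseudo_frobenius T"
proof -
  note D = frobenius_gnsD[OF fT]
  have "y + s \<in> T" if s: "s \<in> T" "s \<noteq> 0" for s
  proof (rule ccontr)
    assume *: "y + s \<notin> T"
    have "y + s + (y + s) = y + y + (s + s)"
      by (simp add: ac_simps)
    moreover have "s + s \<noteq> 0"
      using s(2) by (simp add: vec_eq_iff)
    ultimately have "y + s + (y + s) \<noteq> f"
      using y(2) by simp
    then have "f - (y + s) \<in> T"
      using irr * unfolding irreducible_iff[OF fT] by (auto simp: mirror_gaps_def gaps_def)
    then have "f - y \<in> T"
      using D(2)[OF _ s(1)] reflect_add[OF D(4)[OF *]] by metis
    then show False
      using y by auto
  qed
  then show ?thesis
    using y(1) by (auto simp: pseudo_frobenius_def gaps_def)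
qed

section \<open>Decompositions\<close>

lemma almost_symmetric_decomposition_imp:
  assumes fS: "frobenius_gns S f" and dec: "almost_symmetric_decomposition S f T A"
  shows "almost_symmetric S"
  unfolding almost_symmetric_iff[OF fS]
proof
  have irr: "irreducible_gns T" and fT: "frobenius_gns T f" and S: "S = T - A"
    and PF: "pseudo_frobenius S = pseudo_frobenius T \<union> (\<Union>x\<in>A. {x, f - x})"
    using dec by (auto simp: almost_symmetric_decomposition_def)
  fix y assume y: "y \<in> mirror_gaps S f"
  have le: "y \<le> f"
    using y frobenius_gnsD(4)[OF fS] by (auto simp: mirror_gaps_def gaps_def)
  show "y \<in> pseudo_frobenius S"
  proof (cases "y \<in> A \<or> f - y \<in> A")
    case True
    then show ?thesis
      unfolding PF using reflect_reflect[OF le] by force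
  next
    case False
    then have mir: "y \<in> mirror_gaps T f"
      using y S by (auto simp: mirror_gaps_def gaps_def)
    then have "y + y = f" "y \<notin> T"
      using irr unfolding irreducible_iff[OF fT] by (auto simp: mirror_gaps_def gaps_def)
    then show ?thesis
      using midpoint_in_pseudo_frobenius[OF fT irr] PF by blast
  qed
qed

text \<open>
  Take for \<open>A\<close> the mirror gaps in the upper half provided by \<open>exists_upper_half\<close>. Besides making
  \<open>S \<union> A\<close> a semigroup whose only possible mirror gap is the midpoint, it ensures that sums of two
  nonzero elements of \<open>S \<union> A\<close> all lie in \<open>S\<close>, so no element of \<open>A\<close> is such a sum. The choice matters: an
  arbitrary maximal semigroup that contains \<open>S\<close> and misses \<open>f\<close> is irreducible, too, but may
  contain a point of \<open>L\<close> together with its double.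
\<close>
lemma almost_symmetric_imp_decomposition:
  assumes fS: "frobenius_gns S f" and as: "almost_symmetric S"
  shows "\<exists>T A. almost_symmetric_decomposition S f T A"
proof -
  note D = frobenius_gnsD[OF fS]
  let ?L = "mirror_gaps S f"
  have PF: "pseudo_frobenius S = insert f ?L"
    using as pseudo_frobenius_subset[OF fS] frobenius_in_pseudo_frobenius[OF fS]
    unfolding almost_symmetric_iff[OF fS] by blast
  obtain U where half: "\<And>x. x \<le> f \<Longrightarrow> x + x \<noteq> f \<Longrightarrow> x \<in> U \<longleftrightarrow> f - x \<notin> U"
    and sum: "\<And>x y. x \<in> U \<Longrightarrow> y \<in> U \<Longrightarrow> \<not> x + y \<le> f"
    using exists_upper_half[of f] by blast
  define A where "A = ?L \<inter> U"
  define T where "T = S \<union> A"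
  have disj: "S \<inter> A = {}"
    by (auto simp: A_def mirror_gaps_def gaps_def)
  have L_add: "x + s \<in> S" if "x \<in> ?L" "s \<in> S" "s \<noteq> 0" for x s
    using that PF by (auto simp: pseudo_frobenius_def)
  have add: "a + b \<in> S" if ab: "a \<in> T" "b \<in> T" "a \<noteq> 0" "b \<noteq> 0" for a b
  proof -
    consider "a \<in> S" "b \<in> S" | "a \<in> S" "b \<in> A" | "a \<in> A" "b \<in> S" | "a \<in> A" "b \<in> A"
      using ab by (auto simp: T_def)
    then show ?thesis
    proof cases
      case 1
      then show ?thesis using D(2) by blast
    next
      case 2
      then show ?thesis using L_add[of b a] ab by (simp add: A_def add.commute)
    next
      case 3
      then show ?thesis using L_add[of a b] ab by (simp add: A_def)
    next
      case 4
      then have "\<not> a + b \<le> f" using sum by (simp add: A_def)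
      then show ?thesis using D(4) by blast
    qed
  qed
  have "gns T"
    unfolding gns_def
  proof (intro conjI ballI)
    show "0 \<in> T" using D(1) by (simp add: T_def)
    show "finite (gaps T)"
      using D(5) by (rule rev_finite_subset) (auto simp: gaps_def T_def)
    fix a b assume "a \<in> T" "b \<in> T"
    then show "a + b \<in> T"
      using add[of a b] by (cases "a = 0"; cases "b = 0") (auto simp: T_def)
  qed
  then have fT: "frobenius_gns T f"
    using D(3,4) frobenius_not_mirror_gap[OF fS]
    by (intro frobenius_gnsI) (auto simp: T_def A_def)
  have mid: "x + x = f" if x: "x \<in> mirror_gaps T f" for x
  proof (rule ccontr)
    assume "x + x \<noteq> f"
    have xL: "x \<in> ?L" and xA: "x \<notin> A" "f - x \<notin> A"
      using x by (auto simp: mirror_gaps_def gaps_def T_def)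
    then have "x \<le> f" "f - x \<in> ?L"
      using D(4) mirror_gaps_reflect[OF fS] by (auto simp: mirror_gaps_def gaps_def)
    then show False
      using half[of x] \<open>x + x \<noteq> f\<close> xL xA by (auto simp: A_def)
  qed
  then have irr: "irreducible_gns T"
    using irreducible_iff[OF fT] by blast
  have min: "A \<subseteq> minimal_generators T"
    using add disj D(1) by (auto simp: minimal_generators_def T_def)
  have "pseudo_frobenius S = pseudo_frobenius T \<union> (\<Union>x\<in>A. {x, f - x})"
  proof (intro equalityI subsetI)
    fix x assume "x \<in> pseudo_frobenius S"
    then consider "x = f" | "x \<in> ?L"
      using PF by blast
    then show "x \<in> pseudo_frobenius T \<union> (\<Union>x\<in>A. {x, f - x})"
    proof cases
      case 1
      then show ?thesis using frobenius_in_pseudo_frobenius[OF fT] by simp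
    next
      case 2
      then have le: "x \<le> f" and L': "f - x \<in> ?L" and xS: "x \<notin> S"
        using D(4) mirror_gaps_reflect[OF fS] by (auto simp: mirror_gaps_def gaps_def)
      show ?thesis
      proof (cases "x + x = f")
        case True
        then have "x \<notin> T"
          using sum[of x x] xS by (auto simp: T_def A_def)
        then show ?thesis
          using midpoint_in_pseudo_frobenius[OF fT irr] True by blast
      next
        case False
        then have "x \<in> A \<or> f - x \<in> A"
          using half[OF le] 2 L' by (auto simp: A_def)
        then show ?thesis
          using reflect_reflect[OF le] by (metis UN_I UnCI insertCI)
      qed
    qed
  next
    fix x assume "x \<in> pseudo_frobenius T \<union> (\<Union>x\<in>A. {x, f - x})"
    moreover have "pseudo_frobenius T \<subseteq> insert f ?L"
      using pseudo_frobenius_subset[OF fT] by (auto simp: T_def mirror_gaps_def gaps_def)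
    ultimately show "x \<in> pseudo_frobenius S"
      using PF mirror_gaps_reflect[OF fS] by (auto simp: A_def)
  qed
  moreover have "S = T - A"
    using disj by (auto simp: T_def)
  ultimately show ?thesis
    using irr fT min unfolding almost_symmetric_decomposition_def by blast
qed

text \<open>
  The union that describes \<open>PF(S)\<close> is disjoint: \<open>A\<close> lies in \<open>T\<close>, the other two parts consist of gaps
  of \<open>T\<close>, and \<open>f - x\<close> is not pseudo-Frobenius because adding \<open>x \<in> T - {0}\<close> to it gives the gap \<open>f\<close>.
\<close>
lemma almost_symmetric_decomposition_type:
  assumes fS: "frobenius_gns S f" and dec: "almost_symmetric_decomposition S f T A"
  shows "gns_type S = 2 * card A + gns_type T"
proof -
  have fT: "frobenius_gns T f" and AT: "A \<subseteq> T - {0}" and S: "S = T - A"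
    and PF: "pseudo_frobenius S = pseudo_frobenius T \<union> (\<Union>x\<in>A. {x, f - x})"
    using dec by (auto simp: almost_symmetric_decomposition_def minimal_generators_def)
  note D = frobenius_gnsD[OF fT]
  have le: "x \<le> f" if "x \<in> A" for x
    using frobenius_gnsD(4)[OF fS] S that by blast
  have finA: "finite A"
    using le by (intro finite_subset[OF _ finite_box[of f]]) auto
  have finP: "finite (pseudo_frobenius T)"
    using D(5) by (simp add: pseudo_frobenius_def)
  let ?R = "(\<lambda>x. f - x) ` A"
  have R_gap: "f - x \<notin> T" if "x \<in> A" for x
    using D(2)[of x "f - x"] D(3) add_reflect[OF le[OF that]] AT that by auto
  have R_pf: "f - x \<notin> pseudo_frobenius T" if x: "x \<in> A" for x
  proof
    assume "f - x \<in> pseudo_frobenius T"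
    then have "f - x + x \<in> T"
      using AT x by (auto simp: pseudo_frobenius_def)
    then show False
      using D(3) add_reflect[OF le[OF x]] by (simp add: add.commute)
  qed
  have "inj_on (\<lambda>x. f - x) A"
    by (rule inj_on_inverseI[where g = "\<lambda>x. f - x"]) (simp add: le reflect_reflect)
  then have cardR: "card ?R = card A"
    by (rule card_image)
  have "pseudo_frobenius S = pseudo_frobenius T \<union> (A \<union> ?R)"
    using PF by auto
  moreover have "card (pseudo_frobenius T \<union> (A \<union> ?R)) = card (pseudo_frobenius T) + card (A \<union> ?R)"
    by (rule card_Un_disjoint) (use finA finP AT R_pf in \<open>auto simp: pseudo_frobenius_def gaps_def\<close>)
  moreover have "card (A \<union> ?R) = card A + card ?R"
    by (rule card_Un_disjoint) (use finA AT R_gap in auto)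
  ultimately show ?thesis
    using cardR by (simp add: gns_type_def)
qed

theorem theorem4p8:
  fixes S :: "(nat ^ 'd) set" and f :: "nat ^ 'd"
  assumes "frobenius_gns S f"
  shows "(almost_symmetric S \<longleftrightarrow> (\<exists>T A. almost_symmetric_decomposition S f T A)) \<and>
         (\<forall>T A. almost_symmetric_decomposition S f T A \<longrightarrow>
            gns_type S = 2 * card A + gns_type T)"
  using almost_symmetric_imp_decomposition[OF assms] almost_symmetric_decomposition_imp[OF assms]
    almost_symmetric_decomposition_type[OF assms]
  by blast

end
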